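(* Let $X$, $Y$ be Banach spaces, $C\subseteq X$ and $F:C\to Y$ a continuous function, continuously (Fréchet) differentiable on $\mathrm{int}(C)$. Take $x_0\in \mathrm{int}(C)$, $L, b>0$ and suppose that (1) $F'(x_0)$ is non-singular; (2) $\|F'(x_0)^{-1}[F'(y)-F'(x)]\|\le L\|x-y\|$ for any $x,y\in \mathrm{int}(C)$; (3) $\|F'(x_0)^{-1}F(x_0)\|\le b$; (4) $2bL\le 1$. Define $$t_*:=\frac{1-\sqrt{1-2bL}}{L},\qquad t_{**}:=\frac{1+\sqrt{1-2bL}}{L}.$$ If $B[x_0,t_*]\subset C$, then the sequence $\{x_k\}$ generated by Newton's method for solving $F(x)=0$ with starting point $x_0$, $$x_{k+1}=x_k-F'(x_k)^{-1}F(x_k),\qquad k=0,1,\dots,$$ is well defined (i.e. every $x_k$ lies in $\mathrm{int}(C)$ and every $F'(x_k)$ is non-singular), is contained in $B(x_0,t_* )$, and converges to a point $x_*\in B[x_0,t_*]$ which is the unique zero of $F$ in $B[x_0,t_*]$, and $$\|x_*-x_{k+1}\|\le \tfrac12\|x_*-x_k\|,\qquad k=0,1,\dots.$$ Moreover, if $2bL<1$, then, with $\theta:=t_*/t_{**}<1$, $$\|x_*-x_{k+1}\|\le \frac{1-\theta^{2^k}}{1+\theta^{2^k}}\,\frac{L}{2\sqrt{1-2bL}}\|x_*-x_k\|^2\le \frac{L}{2\sqrt{1-2bL}}\|x_*-x_k\|^2,\qquad k=0,1,\dots,$$ and $x_*$ is the unique zero of $F$ in $B[x_0,\rho]$ for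 any $\rho$ such that $t_*\le\rho<t_{**}$ and $B[x_0,\rho]\subset C$.
   Context: $B(x,r)=\{y\in X: \|x-y\|<r\}$ and $B[x,r]=\{y\in X:\|x-y\|\le r\}$ denote the open and closed balls. $F'$ denotes the Fréchet derivative. A bounded linear operator is called non-singular if it is invertible with bounded inverse. *)

theory Defs
  imports "HOL-Analysis.Analysis"
begin

definition nonsingular :: "('a::real_normed_vector \<Rightarrow>\<^sub>L 'b::real_normed_vector) \<Rightarrow> bool"
  where "nonsingular A \<longleftrightarrow>
    bij (blinfun_apply A) \<and> bounded_linear (inv (blinfun_apply A))"

(* Only meaningful if A is nonsingular; otherwise the value is unspecified. *)
definition blinfun_inverse ::
    "('a::real_normed_vector \<Rightarrow>\<^sub>L 'b::real_normed_vector) \<Rightarrow> ('b \<Rightarrow>\<^sub>L 'a)"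
  where "blinfun_inverse A = Blinfun (inv (blinfun_apply A))"

(* The iteration is a total function. The Newton sequence is well defined in the usual sense
   if every iterate lies in the interior of the domain of F and DF is nonsingular there. *)
primrec newton ::
    "('a::real_normed_vector \<Rightarrow> 'b::real_normed_vector) \<Rightarrow> ('a \<Rightarrow> 'a \<Rightarrow>\<^sub>L 'b) \<Rightarrow> 'a \<Rightarrow> nat \<Rightarrow> 'a"
  where
    "newton F DF x0 0 = x0"
  | "newton F DF x0 (Suc k) =
       newton F DF x0 k
         - blinfun_apply (blinfun_inverse (DF (newton F DF x0 k))) (F (newton F DF x0 k))"

end

theory Submission
  imports Defs
begin

text \<open>
  Composing \<open>F\<close> with \<open>A = F'(x0)\<^sup>-\<^sup>1\<close>, the Lipschitz condition bounds the linearisation error of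
  \<open>A F\<close> between two points by \<open>L/2\<close> times the squared distance, and the Banach perturbation
  lemma bounds \<open>F'(y)\<^sup>-\<^sup>1 w\<close> by \<open>norm (A w) / (1 - L t)\<close> when \<open>norm (y - x0) \<le> t < 1/L\<close>.
  Both bounds are equalities for the majorant \<open>f(t) = L/2 (t1 - t) (t2 - t) = L/2 t\<^sup>2 - t + b\<close>, so
  the steps of Newton's method for \<open>F\<close> from \<open>x0\<close> are dominated by those of Newton's method for \<open>f\<close>
  from \<open>0\<close>, whose iterates satisfy \<open>(t1 - t\<^sub>k) / (t2 - t\<^sub>k) = (t1 / t2) ^ 2 ^ k\<close>. The same comparison,
  started at any zero \<open>z\<close> in the closed ball of radius \<open>\<rho>\<close>, gives
  \<open>norm (z - x\<^sub>k) \<le> (\<rho> / t2) ^ 2 ^ k * (t2 - t\<^sub>k)\<close>; this yields uniqueness and the error bounds.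
\<close>

section \<open>Non-singular operators\<close>

lemma blinfun_inverse_apply:
  assumes "nonsingular A"
  shows "blinfun_apply (blinfun_inverse A) = inv (blinfun_apply A)"
  using assms by (simp add: nonsingular_def blinfun_inverse_def bounded_linear_Blinfun_apply)

lemma blinfun_inverse_left [simp]:
  assumes "nonsingular A"
  shows "blinfun_apply (blinfun_inverse A) (blinfun_apply A v) = v"
  using assms by (simp add: blinfun_inverse_apply nonsingular_def bij_is_inj)

lemma blinfun_inverse_right [simp]:
  assumes "nonsingular A"
  shows "blinfun_apply A (blinfun_apply (blinfun_inverse A) w) = w"
  using assms by (simp add: blinfun_inverse_apply nonsingular_def bij_is_surj surj_f_inv_f)

text \<open>Solving \<open>B v = w\<close> amounts to the fixed-point equation
  \<open>v = A^-1 w - T v\<close>, where \<open>T = A^-1 (B - A)\<close> has norm at most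
  \<open>q\<close>. The same bound on \<open>T\<close> keeps \<open>norm (A^-1 (B v))\<close> above
  \<open>(1 - q) * norm v\<close>, which gives injectivity and the estimate.\<close>

lemma nonsingular_perturbation:
  fixes A B :: "'a::banach \<Rightarrow>\<^sub>L 'b::real_normed_vector"
  assumes A: "nonsingular A"
    and q: "norm (blinfun_inverse A o\<^sub>L (B - A)) \<le> q" "q < 1"
  shows "nonsingular B"
    and "norm (blinfun_inverse B w) \<le> norm (blinfun_inverse A w) / (1 - q)"
proof -
  define T where "T = blinfun_inverse A o\<^sub>L (B - A)"
  have q0: "0 \<le> q" using q(1) norm_ge_zero order_trans by blast
  have T: "norm (T v) \<le> q * norm v" for v
    using norm_blinfun[of T v] q(1) mult_right_mono[of "norm T" q "norm v"] by (simp add: T_def)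
  have T_eq: "T v = blinfun_inverse A (B v) - v" for v
    using A by (simp add: T_def blinfun.diff_left blinfun.diff_right)
  have lower: "(1 - q) * norm v \<le> norm (blinfun_inverse A (B v))" for v
    using T[of v] norm_triangle_ineq4[of "blinfun_inverse A (B v)" "T v"]
    by (simp add: T_eq algebra_simps)
  have "\<exists>v. B v = w" for w
  proof -
    have "\<exists>!v. blinfun_inverse A w - T v = v"
    proof (rule banach_fix_type[OF q0 q(2)], intro allI)
      fix u v
      show "dist (blinfun_inverse A w - T u) (blinfun_inverse A w - T v) \<le> q * dist u v"
        using T[of "v - u"] by (simp add: dist_norm blinfun.diff_right norm_minus_commute)
    qed
    then obtain v where "blinfun_inverse A w - T v = v" by blast
    then have "blinfun_inverse A (B v) = blinfun_inverse A w"
      by (simp add: T_eq algebra_simps)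
    then show ?thesis
      using A by (metis blinfun_inverse_right)
  qed
  then have surj: "surj B" by (metis surjI)
  have inj: "inj B"
  proof (rule injI)
    fix u v assume "B u = B v"
    then have "(1 - q) * norm (u - v) \<le> 0"
      using lower[of "u - v"] by (simp add: blinfun.diff_right)
    then show "u = v" using q(2) by (simp add: mult_le_0_iff)
  qed
  have bound: "norm (inv B w) \<le> norm (blinfun_inverse A w) / (1 - q)" for w
    using lower[of "inv B w"] q(2) surj by (simp add: surj_f_inv_f field_simps)
  have "bounded_linear (inv B)"
  proof (rule bounded_linear_intro)
    show "inv B (x + y) = inv B x + inv B y" for x y
      by (rule injD[OF inj]) (simp add: blinfun.add_right surj_f_inv_f[OF surj])
    show "inv B (r *\<^sub>R x) = r *\<^sub>R inv B x" for r x
      by (rule injD[OF inj]) (simp add: blinfun.scaleR_right surj_f_inv_f[OF surj])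
    show "norm (inv B x) \<le> norm x * (norm (blinfun_inverse A) / (1 - q))" for x
      using order_trans[OF bound divide_right_mono[OF norm_blinfun, of "1 - q"]] q(2)
      by (simp add: mult.commute)
  qed
  then show ns: "nonsingular B"
    using inj surj by (simp add: nonsingular_def bij_def)
  show "norm (blinfun_inverse B w) \<le> norm (blinfun_inverse A w) / (1 - q)"
    using bound ns by (simp add: blinfun_inverse_apply)
qed

section \<open>The linearisation error\<close>

text \<open>The derivative is only needed in the interior of the segment, so that \<open>z\<close> may lie on the
  boundary of the domain.\<close>

lemma linearisation_error_le:
  fixes F :: "'a::real_normed_vector \<Rightarrow> 'b::real_normed_vector"
    and A :: "'b \<Rightarrow>\<^sub>L 'c::real_normed_vector"
  assumes cont: "continuous_on (closed_segment y z) F"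
    and deriv: "\<And>u. u \<in> open_segment y z \<Longrightarrow> (F has_derivative blinfun_apply (F' u)) (at u)"
    and lip: "\<And>u. u \<in> open_segment y z \<Longrightarrow> norm (A o\<^sub>L (F' u - F' y)) \<le> L * norm (u - y)"
  shows "norm (A (F z - F y - F' y (z - y))) \<le> L / 2 * (norm (z - y))\<^sup>2"
proof (cases "y = z")
  case True
  then show ?thesis by simp
next
  case False
  define p where "p s = y + s *\<^sub>R (z - y)" for s :: real
  have p_eq: "p s = (1 - s) *\<^sub>R y + s *\<^sub>R z" for s
    by (simp add: p_def algebra_simps)
  have p_open: "p s \<in> open_segment y z" if "0 < s" "s < 1" for s
    using that False p_eq by (auto simp: in_segment)
  have p_closed: "p ` {0..1} \<subseteq> closed_segment y z"
    by (auto simp: p_eq in_segment)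
  define g where "g s = A (F (p s) - s *\<^sub>R F' y (z - y))" for s
  define g' where "g' s = A ((F' (p s) - F' y) (z - y))" for s
  \<comment> \<open>\<open>norm (g' s)\<close> grows at most linearly in \<open>s\<close>, so a
    quadratic in \<open>s\<close> serves as comparison function; this is the source of the factor
    1/2. The right side is its increment over the unit interval.\<close>
  have "norm (g 1 - g 0) \<le> L / 2 * (norm (z - y))\<^sup>2 * 1\<^sup>2 - L / 2 * (norm (z - y))\<^sup>2 * 0\<^sup>2"
  proof (rule differentiable_bound_general[where f' = g' and \<phi>' = "\<lambda>s. L * (norm (z - y))\<^sup>2 * s"])
    have "continuous_on {0..1} (\<lambda>s. F (p s))"
      by (rule continuous_on_compose2[OF cont _ p_closed])
        (auto simp: p_def intro!: continuous_intros)
    then show "continuous_on {0..1} g"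
      unfolding g_def by (intro continuous_intros)
    show "continuous_on {0..1} (\<lambda>s::real. L / 2 * (norm (z - y))\<^sup>2 * s\<^sup>2)"
      by (intro continuous_intros)
  next
    fix s :: real assume s: "0 < s" "s < 1"
    have p: "(p has_derivative (\<lambda>h. h *\<^sub>R (z - y))) (at s)"
      unfolding p_def by (auto intro!: derivative_eq_intros)
    have "((\<lambda>s. F (p s)) has_derivative (\<lambda>h. F' (p s) (h *\<^sub>R (z - y)))) (at s)"
      by (rule has_derivative_compose[OF p deriv[OF p_open[OF s]]])
    then show "(g has_vector_derivative g' s) (at s)"
      unfolding g_def g'_def has_vector_derivative_def
      by (auto intro!: derivative_eq_intros
          simp: blinfun.scaleR_right blinfun.diff_right blinfun.diff_left scaleR_diff_right)
    show "((\<lambda>s::real. L / 2 * (norm (z - y))\<^sup>2 * s\<^sup>2) has_vector_derivative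
        L * (norm (z - y))\<^sup>2 * s) (at s)"
      unfolding has_real_derivative_iff_has_vector_derivative[symmetric]
      by (auto intro!: derivative_eq_intros)
    have "norm (g' s) \<le> norm (A o\<^sub>L (F' (p s) - F' y)) * norm (z - y)"
      using norm_blinfun[of "A o\<^sub>L (F' (p s) - F' y)" "z - y"] by (simp add: g'_def)
    also have "\<dots> \<le> L * norm (p s - y) * norm (z - y)"
      by (intro mult_right_mono lip p_open s) simp
    also have "\<dots> = L * (norm (z - y))\<^sup>2 * s"
      using s by (simp add: p_def power2_eq_square)
    finally show "norm (g' s) \<le> L * (norm (z - y))\<^sup>2 * s" .
  qed simp
  moreover have "g 1 - g 0 = A (F z - F y - F' y (z - y))"
    by (simp add: g_def p_def blinfun.diff_right)
  ultimately show ?thesis by simp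
qed

section \<open>The majorant iteration\<close>

text \<open>Newton's method from 0 for \<open>f(t) = L / 2 * (t1 - t) * (t2 - t)\<close>; the
  denominator \<open>1 - L * t\<close> is \<open>-f'(t)\<close> once
  \<open>L * (t1 + t2) = 2\<close>.\<close>

primrec majorant_newton :: "real \<Rightarrow> real \<Rightarrow> real \<Rightarrow> nat \<Rightarrow> real" where
  "majorant_newton L t1 t2 0 = 0"
| "majorant_newton L t1 t2 (Suc k) =
     (let t = majorant_newton L t1 t2 k in t + L / 2 * (t1 - t) * (t2 - t) / (1 - L * t))"

text \<open>The relation \<open>L * (t1 + t2) = 2\<close> normalises the majorant to \<open>f'(0) = -1\<close>.\<close>

locale majorant =
  fixes L t1 t2 :: real
  assumes L_pos: "0 < L" and t1_pos: "0 < t1" and t1_le_t2: "t1 \<le> t2"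
    and roots_sum: "L * (t1 + t2) = 2"
begin

abbreviation "t \<equiv> majorant_newton L t1 t2"

lemma L_t1_le: "L * t1 \<le> 1"
proof -
  have "L * t1 \<le> L * t2" using L_pos t1_le_t2 by simp
  then show ?thesis using roots_sum by (simp add: algebra_simps)
qed

text \<open>The vertex of the majorant is \<open>1 / L\<close>, the midpoint of the roots, so
  \<open>t1\<close> does not exceed it. This estimate yields both the positivity of the denominators
  and the two halving results.\<close>

lemma slope_ge: "L * (t1 - s) \<le> 1 - L * s"
  using L_t1_le by (simp add: algebra_simps)

lemma slope_pos: "s < t1 \<Longrightarrow> 0 < 1 - L * s"
  using L_pos slope_ge[of s] mult_pos_pos[of L "t1 - s"] by linarith

text \<open>The denominator is \<open>L / 2\<close> times the sum of the distances to the roots.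
  Both distances are therefore squared and multiplied by one common factor, so their ratio is
  squared.\<close>

lemma roots_minus_step:
  assumes "s < t1" and s': "s' = s + L / 2 * (t1 - s) * (t2 - s) / (1 - L * s)"
  shows "t1 - s' = L / 2 * (t1 - s)\<^sup>2 / (1 - L * s)"
    and "t2 - s' = L / 2 * (t2 - s)\<^sup>2 / (1 - L * s)"
proof -
  define D where "D = 1 - L * s"
  have D: "D \<noteq> 0" "D = L / 2 * ((t1 - s) + (t2 - s))"
    using slope_pos[OF assms(1)] roots_sum by (auto simp: D_def algebra_simps)
  have s'_eq: "s' * D = s * D + L / 2 * (t1 - s) * (t2 - s)"
    using D(1) by (simp add: s' D_def[symmetric] distrib_right)
  have "(t1 - s') * D = (t1 - s) * D - L / 2 * (t1 - s) * (t2 - s)"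
    using s'_eq by (simp add: algebra_simps)
  also have "\<dots> = L / 2 * (t1 - s)\<^sup>2"
    unfolding D(2) by (simp add: power2_eq_square field_simps)
  finally show "t1 - s' = L / 2 * (t1 - s)\<^sup>2 / (1 - L * s)"
    using D(1) by (simp add: D_def[symmetric] eq_divide_eq)
  have "(t2 - s') * D = (t2 - s) * D - L / 2 * (t1 - s) * (t2 - s)"
    using s'_eq by (simp add: algebra_simps)
  also have "\<dots> = L / 2 * (t2 - s)\<^sup>2"
    unfolding D(2) by (simp add: power2_eq_square field_simps)
  finally show "t2 - s' = L / 2 * (t2 - s)\<^sup>2 / (1 - L * s)"
    using D(1) by (simp add: D_def[symmetric] eq_divide_eq)
qed

lemma t_less: "t k < t1"
proof (induction k)
  case 0
  then show ?case using t1_pos by simp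
next
  case (Suc k)
  have "0 < L / 2 * (t1 - t k)\<^sup>2 / (1 - L * t k)"
    using Suc slope_pos[OF Suc] L_pos by simp
  then show ?case
    using roots_minus_step(1)[OF Suc, of "t (Suc k)"] by (simp add: Let_def)
qed

lemma step_denom_pos: "0 < 1 - L * t k"
  using slope_pos[OF t_less] .

lemma t_Suc: "t (Suc k) = t k + L / 2 * (t1 - t k) * (t2 - t k) / (1 - L * t k)"
  by (simp add: Let_def)

declare majorant_newton.simps(2) [simp del]

lemma t1_minus_t_Suc: "t1 - t (Suc k) = L / 2 * (t1 - t k)\<^sup>2 / (1 - L * t k)"
  and t2_minus_t_Suc: "t2 - t (Suc k) = L / 2 * (t2 - t k)\<^sup>2 / (1 - L * t k)"
  using roots_minus_step[OF t_less t_Suc] by blast+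

text \<open>After multiplication by \<open>L / 2\<close> the right side is the majorant at
  \<open>t (Suc k)\<close>: for a quadratic the linearisation error bound is attained.\<close>

lemma t_Suc_diff_sq: "(t (Suc k) - t k)\<^sup>2 = (t1 - t (Suc k)) * (t2 - t (Suc k))"
proof -
  have "t (Suc k) - t k = L / 2 * (t1 - t k) * (t2 - t k) / (1 - L * t k)"
    using t_Suc[of k] by simp
  then show ?thesis
    unfolding t1_minus_t_Suc t2_minus_t_Suc by (simp add: power2_eq_square)
qed

lemma t_Suc_mono: "t k \<le> t (Suc k)"
  using t_less[of k] t1_le_t2 L_pos step_denom_pos[of k] by (simp add: t_Suc)

lemma t_mono: "j \<le> k \<Longrightarrow> t j \<le> t k"
  using lift_Suc_mono_le[of t] t_Suc_mono by blast

lemma t_nonneg: "0 \<le> t k"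
  using t_mono[of 0 k] by simp

text \<open>By \<open>slope_ge\<close> the factor \<open>L * (t1 - t k) / (1 - L * t k)\<close> is
  at most 1. It equals 1 when \<open>t1 = t2\<close>, where convergence is only linear; halving
  covers both cases.\<close>

lemma t1_minus_t_halves: "t1 - t (Suc k) \<le> (t1 - t k) / 2"
proof -
  have "L * (t1 - t k) * (t1 - t k) \<le> (1 - L * t k) * (t1 - t k)"
    using slope_ge t_less[of k] by (intro mult_right_mono) auto
  then show ?thesis
    using step_denom_pos[of k] by (simp add: t1_minus_t_Suc power2_eq_square field_simps)
qed

lemma t_tendsto: "t \<longlonglongrightarrow> t1"
proof -
  have bound: "t1 - t k \<le> t1 * (1 / 2) ^ k" for k
  proof (induction k)
    case (Suc k)
    then show ?case using t1_minus_t_halves[of k] by simp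
  qed simp
  have "(\<lambda>k. t1 - t k) \<longlonglongrightarrow> 0"
  proof (rule Lim_null_comparison)
    show "\<forall>\<^sub>F k in sequentially. norm (t1 - t k) \<le> t1 * (1 / 2) ^ k"
      using bound t_less by (simp add: less_imp_le)
    show "(\<lambda>k. t1 * (1 / 2) ^ k) \<longlonglongrightarrow> 0"
      by (intro tendsto_mult_right_zero LIMSEQ_power_zero) simp
  qed
  then show ?thesis
    using tendsto_diff[OF tendsto_const[of t1]] by fastforce
qed

text \<open>The ratio of the distances to the roots starts at \<open>t1 / t2\<close> and is squared
  by each step.\<close>

lemma t1_minus_t_eq: "t1 - t k = (t1 / t2) ^ 2 ^ k * (t2 - t k)"
proof (induction k)
  case 0
  then show ?case using t1_pos t1_le_t2 by simp
next
  case (Suc k)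
  have "(t1 - t k)\<^sup>2 = (t1 / t2) ^ 2 ^ Suc k * (t2 - t k)\<^sup>2"
    unfolding Suc.IH by (simp add: power_mult_distrib mult.commute flip: power_mult)
  then show ?case
    by (simp only: t1_minus_t_Suc t2_minus_t_Suc times_divide_eq_right mult.left_commute)
qed

text \<open>Gives the coefficient of the quadratic error estimate in closed form: all terms are
  multiples of \<open>t2 - t k\<close>, which cancels.\<close>

lemma inverse_slope_eq:
  assumes "t1 < t2"
  defines "q k \<equiv> (t1 / t2) ^ 2 ^ k"
  shows "L / 2 / (1 - L * t k) = (1 - q k) / (1 + q k) * (1 / (t2 - t1))"
proof -
  have "t1 / t2 < 1" "0 \<le> t1 / t2" using assms(1) t1_pos by auto
  then have q: "0 \<le> q k" "q k < 1"
    by (auto simp: q_def power_Suc_less_one power_less_one_iff)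
  have r: "0 < t2 - t k" using t_less[of k] t1_le_t2 by simp
  have 1: "1 - L * t k = L / 2 * ((t1 - t k) + (t2 - t k))"
    using roots_sum by (simp add: algebra_simps)
  have 2: "t1 - t k = q k * (t2 - t k)" using t1_minus_t_eq by (simp add: q_def)
  have 3: "t2 - t1 = (1 - q k) * (t2 - t k)" using 2 by (simp add: algebra_simps)
  have 4: "1 - L * t k = L / 2 * ((1 + q k) * (t2 - t k))"
    unfolding 1 2 by (simp add: algebra_simps)
  show ?thesis
    unfolding 3 4 using q r L_pos by simp
qed

end

section \<open>Comparison of the two iterations\<close>

text \<open>The bound in \<open>init\<close> is the majorant at 0, which takes the place of the
  constant \<open>b\<close>.\<close>

locale kantorovich = majorant L t1 t2 for L t1 t2 :: real +
  fixes F :: "'a::banach \<Rightarrow> 'b::banach" and F' :: "'a \<Rightarrow> 'a \<Rightarrow>\<^sub>L 'b"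
    and C :: "'a set" and x0 :: 'a
  assumes F_cont: "continuous_on C F"
    and F_deriv: "\<And>y. y \<in> interior C \<Longrightarrow> (F has_derivative blinfun_apply (F' y)) (at y)"
    and nonsing: "nonsingular (F' x0)"
    and lipschitz: "\<And>y z. y \<in> interior C \<Longrightarrow> z \<in> interior C \<Longrightarrow>
          norm (blinfun_inverse (F' x0) o\<^sub>L (F' z - F' y)) \<le> L * norm (y - z)"
    and init: "norm (blinfun_apply (blinfun_inverse (F' x0)) (F x0)) \<le> L / 2 * t1 * t2"
    and ball_sub: "cball x0 t1 \<subseteq> C"
begin

abbreviation "A \<equiv> blinfun_inverse (F' x0)"
abbreviation "x \<equiv> newton F F' x0"

lemma ball_subset_interior: "cball x0 r \<subseteq> C \<Longrightarrow> ball x0 r \<subseteq> interior C"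
  by (meson ball_subset_cball interior_maximal open_ball order_trans)

text \<open>As \<open>y\<close> is strictly inside the ball, the segment can meet the sphere only at
  \<open>z\<close>. Zeros are only known to lie in closed balls, so \<open>z\<close> must be allowed
  there.\<close>

lemma linearisation_error:
  assumes "cball x0 r \<subseteq> C" "y \<in> ball x0 r" "z \<in> cball x0 r"
  shows "norm (A (F z - F y - F' y (z - y))) \<le> L / 2 * (norm (z - y))\<^sup>2"
proof (rule linearisation_error_le)
  have y: "y \<in> cball x0 r" using assms(2) by simp
  have "closed_segment y z \<subseteq> C"
    using closed_segment_subset[OF y assms(3)] assms(1) by auto
  then show "continuous_on (closed_segment y z) F"
    using F_cont continuous_on_subset by blast
next
  fix u assume u: "u \<in> open_segment y z"
  then obtain s where s: "0 < s" "s < 1" "u = (1 - s) *\<^sub>R y + s *\<^sub>R z"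
    by (auto simp: in_segment)
  have "x0 - u = (1 - s) *\<^sub>R (x0 - y) + s *\<^sub>R (x0 - z)"
    by (simp add: s(3) algebra_simps)
  then have "norm (x0 - u) \<le> (1 - s) * norm (x0 - y) + s * norm (x0 - z)"
    using s norm_triangle_ineq[of "(1 - s) *\<^sub>R (x0 - y)" "s *\<^sub>R (x0 - z)"] by simp
  also have "\<dots> < (1 - s) * r + s * r"
    using s assms(2,3) by (intro add_less_le_mono mult_strict_left_mono mult_left_mono)
      (auto simp: dist_norm)
  finally have "u \<in> ball x0 r" by (simp add: dist_norm algebra_simps)
  then have u: "u \<in> interior C" and y: "y \<in> interior C"
    using ball_subset_interior assms by blast+
  show "(F has_derivative blinfun_apply (F' u)) (at u)" using F_deriv u .
  show "norm (A o\<^sub>L (F' u - F' y)) \<le> L * norm (u - y)"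
    using lipschitz[OF y u] by (simp add: norm_minus_commute)
qed

text \<open>The perturbation lemma with \<open>q = L * s\<close>, which is below 1 because
  \<open>s < t1\<close> and \<open>L * t1\<close> is at most 1. For \<open>s = t k\<close> the
  denominator is that of the majorant step.\<close>

lemma
  assumes "norm (y - x0) \<le> s" "s < t1"
  shows nonsingular_deriv: "nonsingular (F' y)"
    and inverse_deriv_le: "norm (blinfun_inverse (F' y) w) \<le> norm (A w) / (1 - L * s)"
proof -
  have "y \<in> ball x0 t1" "x0 \<in> ball x0 t1"
    using assms t1_pos by (auto simp: dist_norm norm_minus_commute)
  then have "norm (A o\<^sub>L (F' y - F' x0)) \<le> L * norm (x0 - y)"
    using ball_subset_interior[OF ball_sub] lipschitz by blast
  also have "\<dots> \<le> L * s"
    using assms L_pos by (simp add: norm_minus_commute)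
  finally have *: "norm (A o\<^sub>L (F' y - F' x0)) \<le> L * s" .
  have "L * s < 1" using slope_pos[OF assms(2)] by simp
  then show "nonsingular (F' y)"
    and "norm (blinfun_inverse (F' y) w) \<le> norm (A w) / (1 - L * s)"
    using nonsingular_perturbation[OF nonsing *] by auto
qed

lemma newton_step_le:
  assumes y: "norm (x k - x0) \<le> t k" and F: "norm (A (F (x k))) \<le> L / 2 * (t1 - t k) * (t2 - t k)"
  shows "norm (x (Suc k) - x k) \<le> t (Suc k) - t k"
proof -
  have "norm (x (Suc k) - x k) \<le> norm (A (F (x k))) / (1 - L * t k)"
    using inverse_deriv_le[OF y t_less] by simp
  also have "\<dots> \<le> L / 2 * (t1 - t k) * (t2 - t k) / (1 - L * t k)"
    using F step_denom_pos[of k] by (intro divide_right_mono) auto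
  finally show ?thesis using t_Suc[of k] by simp
qed

text \<open>Position and residual need a joint induction: the residual controls the next step, and
  the step controls both the next position and, through the linearisation error, the next
  residual.\<close>

lemma newton_invariant:
  "norm (x k - x0) \<le> t k \<and> norm (A (F (x k))) \<le> L / 2 * (t1 - t k) * (t2 - t k)"
proof (induction k)
  case 0
  then show ?case using init by simp
next
  case (Suc k)
  note step = newton_step_le[OF conjunct1[OF Suc] conjunct2[OF Suc]]
  have "norm (x (Suc k) - x0) \<le> norm (x (Suc k) - x k) + norm (x k - x0)"
    using norm_triangle_ineq[of "x (Suc k) - x k" "x k - x0"] by (simp del: newton.simps)
  then have dist: "norm (x (Suc k) - x0) \<le> t (Suc k)"
    using step Suc by linarith
  have in_ball: "x k \<in> ball x0 t1" "x (Suc k) \<in> cball x0 t1"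
    using Suc dist t_less[of k] t_less[of "Suc k"]
    by (auto simp: dist_norm norm_minus_commute simp del: newton.simps)
  \<comment> \<open>By the Newton equation the linearisation at \<open>x k\<close> vanishes at
    \<open>x (Suc k)\<close>, so the linearisation error there is \<open>F (x (Suc k))\<close>
    itself.\<close>
  have "F' (x k) (x (Suc k) - x k) = - F (x k)"
    using nonsingular_deriv[OF conjunct1[OF Suc] t_less] by (simp add: blinfun.minus_right)
  then have "norm (A (F (x (Suc k)))) \<le> L / 2 * (norm (x (Suc k) - x k))\<^sup>2"
    using linearisation_error[OF ball_sub in_ball] by (simp del: newton.simps)
  also have "\<dots> \<le> L / 2 * (t (Suc k) - t k)\<^sup>2"
    using step L_pos by (intro mult_left_mono power_mono) auto
  also have "\<dots> = L / 2 * (t1 - t (Suc k)) * (t2 - t (Suc k))"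
    by (simp only: t_Suc_diff_sq mult.assoc)
  finally show ?case using dist by blast
qed

lemma newton_dist_le: "norm (x k - x0) \<le> t k"
  using newton_invariant by blast

lemma newton_in_ball: "x k \<in> ball x0 t1"
  using newton_dist_le[of k] t_less[of k] by (simp add: dist_norm norm_minus_commute)

lemma newton_nonsingular: "nonsingular (F' (x k))"
  using nonsingular_deriv[OF newton_dist_le t_less] .

lemma newton_diff_le: "j \<le> k \<Longrightarrow> norm (x k - x j) \<le> t k - t j"
proof (induction k rule: dec_induct)
  case (step k)
  have "norm (x (Suc k) - x k) \<le> t (Suc k) - t k"
    using newton_step_le newton_invariant by blast
  then show ?case
    using step norm_triangle_ineq[of "x (Suc k) - x k" "x k - x j"]
    by (simp del: newton.simps)
qed simp

section \<open>The limit of the Newton sequence\<close>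

lemma newton_convergent: "convergent x"
proof (rule Cauchy_convergent, rule metric_CauchyI)
  fix e :: real assume "0 < e"
  then obtain N where N: "\<And>k. N \<le> k \<Longrightarrow> norm (t k - t1) < e / 2"
    using LIMSEQ_D[OF t_tendsto half_gt_zero] by blast
  have le: "dist (x k) (x N) < e / 2" if "N \<le> k" for k
    using newton_diff_le[OF that] t_less[of k] t_less[of N] N[OF order_refl]
    by (simp add: dist_norm)
  have "dist (x m) (x n) < e" if "N \<le> m" "N \<le> n" for m n
    using le[OF that(1)] le[OF that(2)] dist_triangle2[of "x m" "x n" "x N"] by linarith
  then show "\<exists>M. \<forall>m\<ge>M. \<forall>n\<ge>M. dist (x m) (x n) < e" by blast
qed

text \<open>The residual bound tends to the majorant at its root \<open>t1\<close>, which is 0. The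
  limit may lie on the sphere, so the continuity of \<open>F\<close> on all of \<open>C\<close> is
  used.\<close>

lemma newton_limit:
  assumes lim: "x \<longlonglongrightarrow> xs"
  shows "xs \<in> cball x0 t1" and "F xs = 0"
proof -
  have in_cball: "x k \<in> cball x0 t1" for k
    using newton_in_ball[of k] ball_subset_cball by blast
  show xs: "xs \<in> cball x0 t1"
    using Lim_in_closed_set[OF closed_cball _ _ lim] in_cball by simp
  have "(\<lambda>k. F (x k)) \<longlonglongrightarrow> F xs"
    using xs in_cball ball_sub
    by (intro continuous_on_tendsto_compose[OF F_cont lim] always_eventually) auto
  then have 1: "(\<lambda>k. norm (A (F (x k)))) \<longlonglongrightarrow> norm (A (F xs))"
    by (intro tendsto_intros)
  have "(\<lambda>k. L / 2 * (t1 - t k) * (t2 - t k)) \<longlonglongrightarrow> L / 2 * (t1 - t1) * (t2 - t1)"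
    by (intro tendsto_intros t_tendsto)
  then have "norm (A (F xs)) \<le> L / 2 * (t1 - t1) * (t2 - t1)"
    using LIMSEQ_le[OF 1] newton_invariant by blast
  then have "A (F xs) = 0" by simp
  then show "F xs = 0"
    using blinfun_inverse_right[OF nonsing, of "F xs"] by simp
qed

section \<open>Distance to an arbitrary zero: error bounds and uniqueness\<close>

lemma error_step_le:
  assumes "cball x0 r \<subseteq> C" "t1 \<le> r" "z \<in> cball x0 r" "F z = 0"
  shows "norm (z - x (Suc k)) \<le> L / 2 / (1 - L * t k) * (norm (z - x k))\<^sup>2"
proof -
  let ?w = "F z - F (x k) - F' (x k) (z - x k)"
  \<comment> \<open>Since \<open>F z = 0\<close>, the new error is, up to sign, the inverse
    derivative applied to the linearisation error from \<open>x k\<close> to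
    \<open>z\<close>.\<close>
  have "z - x (Suc k) = - blinfun_inverse (F' (x k)) ?w"
    using newton_nonsingular[of k] assms(4)
    by (simp add: blinfun.diff_right blinfun.minus_right)
  then have "norm (z - x (Suc k)) \<le> norm (A ?w) / (1 - L * t k)"
    using inverse_deriv_le[OF newton_dist_le t_less] by (metis norm_minus_cancel)
  also have "\<dots> \<le> L / 2 * (norm (z - x k))\<^sup>2 / (1 - L * t k)"
    using newton_in_ball[of k] assms step_denom_pos[of k]
    by (intro divide_right_mono linearisation_error[of r]) auto
  finally show ?thesis by simp
qed

text \<open>\<open>t2 - t k\<close> satisfies with equality the recursion that
  \<open>error_step_le\<close> gives as an inequality. So the quotient of
  \<open>norm (z - x k)\<close> by \<open>t2 - t k\<close> is at most squared in each step, and it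
  starts at no more than \<open>r / t2\<close>.\<close>

lemma zero_dist_le:
  assumes "cball x0 r \<subseteq> C" "t1 \<le> r" "z \<in> cball x0 r" "F z = 0"
  shows "norm (z - x k) \<le> (r / t2) ^ 2 ^ k * (t2 - t k)"
proof (induction k)
  case 0
  then show ?case
    using assms(3) t1_pos t1_le_t2 by (simp add: dist_norm norm_minus_commute)
next
  case (Suc k)
  have c: "0 \<le> L / 2 / (1 - L * t k)" using L_pos step_denom_pos[of k] by simp
  have "norm (z - x (Suc k)) \<le> L / 2 / (1 - L * t k) * (norm (z - x k))\<^sup>2"
    by (rule error_step_le[OF assms])
  also have "\<dots> \<le> L / 2 / (1 - L * t k) * ((r / t2) ^ 2 ^ k * (t2 - t k))\<^sup>2"
    using Suc c by (intro mult_left_mono power_mono) auto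
  also have "((r / t2) ^ 2 ^ k * (t2 - t k))\<^sup>2 = (r / t2) ^ 2 ^ Suc k * (t2 - t k)\<^sup>2"
    by (simp add: power_mult_distrib mult.commute flip: power_mult)
  also have "L / 2 / (1 - L * t k) * \<dots> = (r / t2) ^ 2 ^ Suc k * (t2 - t (Suc k))"
    unfolding t2_minus_t_Suc by simp
  finally show ?case .
qed

lemma zero_dist_le_t1:
  assumes "z \<in> cball x0 t1" "F z = 0"
  shows "norm (z - x k) \<le> t1 - t k"
  using zero_dist_le[OF ball_sub order_refl assms, of k] t1_minus_t_eq[of k] by simp

text \<open>Uniqueness follows from uniqueness of limits. This version includes
  \<open>t1 = t2\<close>, where the geometric ratio used for the outer ball would be 1.\<close>

lemma zero_in_inner_ball_is_limit:
  assumes "z \<in> cball x0 t1" "F z = 0"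
  shows "x \<longlonglongrightarrow> z"
proof (rule LIM_zero_cancel, rule Lim_null_comparison)
  show "\<forall>\<^sub>F k in sequentially. norm (x k - z) \<le> t1 - t k"
    using zero_dist_le_t1[OF assms] by (simp add: norm_minus_commute)
  show "(\<lambda>k. t1 - t k) \<longlonglongrightarrow> 0"
    using tendsto_diff[OF tendsto_const[of t1] t_tendsto] by simp
qed

lemma zero_in_outer_ball_is_limit:
  assumes "cball x0 r \<subseteq> C" "t1 \<le> r" "r < t2" "z \<in> cball x0 r" "F z = 0"
  shows "x \<longlonglongrightarrow> z"
proof (rule LIM_zero_cancel, rule Lim_null_comparison)
  have r: "0 \<le> r / t2" "r / t2 < 1" using assms t1_pos by auto
  have "norm (z - x k) \<le> (r / t2) ^ k * t2" for k
  proof -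
    have "norm (z - x k) \<le> (r / t2) ^ 2 ^ k * (t2 - t k)"
      using zero_dist_le assms by blast
    \<comment> \<open>Lowering the exponent from \<open>2 ^ k\<close> to \<open>k\<close> gives up
      the rate but leaves a geometric null sequence.\<close>
    also have "\<dots> \<le> (r / t2) ^ k * t2"
      using r t_nonneg[of k] t_less[of k] t1_le_t2 less_exp[of k]
      by (intro mult_mono power_decreasing) auto
    finally show ?thesis .
  qed
  then show "\<forall>\<^sub>F k in sequentially. norm (x k - z) \<le> (r / t2) ^ k * t2"
    by (simp add: norm_minus_commute)
  show "(\<lambda>k. (r / t2) ^ k * t2) \<longlonglongrightarrow> 0"
    using r by (intro tendsto_mult_left_zero LIMSEQ_power_zero) simp
qed

text \<open>One of the two factors \<open>norm (z - x k)\<close> in the quadratic estimate is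
  replaced by its bound \<open>t1 - t k\<close>; \<open>slope_ge\<close> does the rest.\<close>

lemma error_halves:
  assumes "z \<in> cball x0 t1" "F z = 0"
  shows "norm (z - x (Suc k)) \<le> 1 / 2 * norm (z - x k)"
proof -
  have "norm (z - x (Suc k)) \<le> L / 2 / (1 - L * t k) * (norm (z - x k) * norm (z - x k))"
    using error_step_le[OF ball_sub order_refl assms, of k] by (simp only: power2_eq_square)
  also have "\<dots> \<le> L / 2 / (1 - L * t k) * ((t1 - t k) * norm (z - x k))"
    using zero_dist_le_t1[OF assms, of k] L_pos step_denom_pos[of k]
    by (intro mult_left_mono mult_right_mono) auto
  also have "\<dots> = L * (t1 - t k) / (1 - L * t k) * (1 / 2 * norm (z - x k))"
    by (simp add: mult.assoc mult.commute[of 2])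
  also have "\<dots> \<le> 1 * (1 / 2 * norm (z - x k))"
    using slope_ge[of "t k"] step_denom_pos[of k] by (intro mult_right_mono) auto
  finally show ?thesis by simp
qed

end

section \<open>Specialisation to the roots determined by \<open>b\<close> and
  \<open>L\<close>\<close>

theorem theorem1:
  fixes F :: "'a::banach \<Rightarrow> 'b::banach"
    and F' :: "'a \<Rightarrow> 'a \<Rightarrow>\<^sub>L 'b"
    and C :: "'a set" and x0 :: 'a
    and L b t1 t2 \<theta> :: real
    and x :: "nat \<Rightarrow> 'a"
  assumes F_cont: "continuous_on C F"
    and F_deriv: "\<And>y. y \<in> interior C \<Longrightarrow> (F has_derivative blinfun_apply (F' y)) (at y)"
    and F'_cont: "continuous_on (interior C) F'"
    and x0: "x0 \<in> interior C"
    and L_pos: "L > 0"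
    and b_pos: "b > 0"
    and nonsing: "nonsingular (F' x0)"
    and lipschitz: "\<And>y z. y \<in> interior C \<Longrightarrow> z \<in> interior C \<Longrightarrow>
          norm (blinfun_inverse (F' x0) o\<^sub>L (F' z - F' y)) \<le> L * norm (y - z)"
    and init: "norm (blinfun_apply (blinfun_inverse (F' x0)) (F x0)) \<le> b"
    and bL: "2 * b * L \<le> 1"
    and t1_def: "t1 = (1 - sqrt (1 - 2 * b * L)) / L"
    and t2_def: "t2 = (1 + sqrt (1 - 2 * b * L)) / L"
    and theta_def: "\<theta> = t1 / t2"
    and ball_sub: "cball x0 t1 \<subseteq> C"
    and x_def: "x = newton F F' x0"
  shows "(\<forall>k. x k \<in> interior C \<and> nonsingular (F' (x k))) \<and>
    (\<forall>k. x k \<in> ball x0 t1) \<and>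
    (\<exists>xs \<in> cball x0 t1.
       x \<longlonglongrightarrow> xs \<and>
       F xs = 0 \<and> (\<forall>z \<in> cball x0 t1. F z = 0 \<longrightarrow> z = xs) \<and>
       (\<forall>k. norm (xs - x (Suc k)) \<le> 1 / 2 * norm (xs - x k)) \<and>
       (2 * b * L < 1 \<longrightarrow>
          \<theta> < 1 \<and>
          (\<forall>k. norm (xs - x (Suc k))
                 \<le> (1 - \<theta> ^ (2 ^ k)) / (1 + \<theta> ^ (2 ^ k)) * (L / (2 * sqrt (1 - 2 * b * L)))
                     * (norm (xs - x k))\<^sup>2 \<and>
               (1 - \<theta> ^ (2 ^ k)) / (1 + \<theta> ^ (2 ^ k)) * (L / (2 * sqrt (1 - 2 * b * L)))
                     * (norm (xs - x k))\<^sup>2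
                 \<le> L / (2 * sqrt (1 - 2 * b * L)) * (norm (xs - x k))\<^sup>2) \<and>
          (\<forall>\<rho>. t1 \<le> \<rho> \<and> \<rho> < t2 \<and> cball x0 \<rho> \<subseteq> C \<longrightarrow>
               xs \<in> cball x0 \<rho> \<and> F xs = 0 \<and> (\<forall>z \<in> cball x0 \<rho>. F z = 0 \<longrightarrow> z = xs))))"
proof -
  define s where "s = sqrt (1 - 2 * b * L)"
  have s: "0 \<le> s" "s\<^sup>2 = 1 - 2 * b * L" using bL by (auto simp: s_def)
  have "s < 1" using b_pos L_pos by (auto simp: s_def)
  have t1: "L * t1 = 1 - s" and t2: "L * t2 = 1 + s"
    using L_pos by (auto simp: t1_def t2_def s_def)
  \<comment> \<open>Since \<open>(1 - s) * (1 + s) = 2 * b * L\<close>, the majorant at 0 is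
    \<open>b\<close>, as the locale requires.\<close>
  have b_eq: "L / 2 * t1 * t2 = b"
  proof -
    have "L * (L / 2 * t1 * t2) = (L * t1) * (L * t2) / 2" by simp
    also have "\<dots> = L * b" unfolding t1 t2 using s(2) by (simp add: algebra_simps power2_eq_square)
    finally show ?thesis using L_pos by simp
  qed
  interpret kantorovich L t1 t2 F F' C x0
  proof
    show "0 < t1" "t1 \<le> t2"
      using L_pos \<open>s < 1\<close> s by (auto simp: t1_def t2_def s_def[symmetric] divide_right_mono)
    show "L * (t1 + t2) = 2" using t1 t2 by (simp add: distrib_left)
  qed (use assms b_eq in auto)
  obtain xs where lim: "newton F F' x0 \<longlonglongrightarrow> xs"
    using newton_convergent convergent_def by blast
  note xs = newton_limit[OF lim]
  have unique1: "z = xs" if "z \<in> cball x0 t1" "F z = 0" for z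
    using LIMSEQ_unique[OF zero_in_inner_ball_is_limit[OF that] lim] .
  have strict: "\<theta> < 1 \<and>
      (\<forall>k. norm (xs - x (Suc k))
             \<le> (1 - \<theta> ^ (2 ^ k)) / (1 + \<theta> ^ (2 ^ k)) * (L / (2 * s)) * (norm (xs - x k))\<^sup>2 \<and>
           (1 - \<theta> ^ (2 ^ k)) / (1 + \<theta> ^ (2 ^ k)) * (L / (2 * s)) * (norm (xs - x k))\<^sup>2
             \<le> L / (2 * s) * (norm (xs - x k))\<^sup>2) \<and>
      (\<forall>\<rho>. t1 \<le> \<rho> \<and> \<rho> < t2 \<and> cball x0 \<rho> \<subseteq> C \<longrightarrow>
           xs \<in> cball x0 \<rho> \<and> F xs = 0 \<and> (\<forall>z \<in> cball x0 \<rho>. F z = 0 \<longrightarrow> z = xs))"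
    if "2 * b * L < 1"
  proof (intro conjI allI impI ballI)
    have "0 < s" using that by (simp add: s_def)
    have "L * t1 < L * t2" unfolding t1 t2 using \<open>0 < s\<close> by simp
    then have less: "t1 < t2" using L_pos by simp
    then have \<theta>: "0 \<le> \<theta>" "\<theta> < 1" using t1_pos by (auto simp: theta_def)
    then show "\<theta> < 1" by simp
    \<comment> \<open>Turns the factor from \<open>inverse_slope_eq\<close> into the stated
      constant, since the roots are \<open>2 * s / L\<close> apart.\<close>
    have diff: "1 / (t2 - t1) = L / (2 * s)"
    proof -
      have "L * (t2 - t1) = 2 * s" using t1 t2 by (simp add: right_diff_distrib)
      then show ?thesis using \<open>0 < s\<close> less by (simp add: field_simps)
    qed
    fix k
    show "norm (xs - x (Suc k))
        \<le> (1 - \<theta> ^ (2 ^ k)) / (1 + \<theta> ^ (2 ^ k)) * (L / (2 * s)) * (norm (xs - x k))\<^sup>2"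
      using error_step_le[OF ball_sub order_refl xs, of k] inverse_slope_eq[OF less, of k]
      by (simp only: x_def theta_def diff)
    have "(1 - \<theta> ^ (2 ^ k)) / (1 + \<theta> ^ (2 ^ k)) \<le> 1"
      using zero_le_power[OF \<theta>(1), of "2 ^ k"] by (simp add: divide_le_eq_1)
    then show "(1 - \<theta> ^ (2 ^ k)) / (1 + \<theta> ^ (2 ^ k)) * (L / (2 * s)) * (norm (xs - x k))\<^sup>2
        \<le> L / (2 * s) * (norm (xs - x k))\<^sup>2"
      using mult_right_mono[of _ 1 "L / (2 * s) * (norm (xs - x k))\<^sup>2"] L_pos \<open>0 < s\<close>
      by (metis (no_types) divide_nonneg_pos mult.assoc mult_1 mult_nonneg_nonneg
          mult_pos_pos order_less_imp_le zero_le_power2 zero_less_numeral)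
  next
    fix \<rho> assume "t1 \<le> \<rho> \<and> \<rho> < t2 \<and> cball x0 \<rho> \<subseteq> C"
    then show "xs \<in> cball x0 \<rho>" and "F xs = 0" using xs by auto
  next
    fix \<rho> z assume "t1 \<le> \<rho> \<and> \<rho> < t2 \<and> cball x0 \<rho> \<subseteq> C" "z \<in> cball x0 \<rho>" "F z = 0"
    then show "z = xs"
      using LIMSEQ_unique[OF zero_in_outer_ball_is_limit lim] by blast
  qed
  show ?thesis
  proof (intro conjI bexI[of _ xs])
    show "\<forall>k. x k \<in> interior C \<and> nonsingular (F' (x k))"
      using newton_in_ball newton_nonsingular ball_subset_interior[OF ball_sub] x_def by blast
    show "\<forall>k. x k \<in> ball x0 t1"
      using newton_in_ball x_def by blast
    show "\<forall>k. norm (xs - x (Suc k)) \<le> 1 / 2 * norm (xs - x k)"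
      using error_halves[OF xs] x_def by blast
    show "x \<longlonglongrightarrow> xs" using lim unfolding x_def .
    show "\<forall>z\<in>cball x0 t1. F z = 0 \<longrightarrow> z = xs" using unique1 by blast
  qed (rule xs | rule impI, erule strict[unfolded s_def])+
qed

end
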